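(* Let $(V,\Omega)$ be a finite-dimensional symplectic vector space, identified with $\mathbb{R}^{2k}$ in Darboux coordinates, and $W=\mathbb{R}^d$ with $d\ge2$. Then the map $$\operatorname{Jac}(V,\Omega;W)\to\operatorname{Diff}\big(L(W,V),\Omega^W\big)\times_B\operatorname{Sym}(W),\qquad(g,\mathbf{V},S)\mapsto(\tau_{\mathbf{V}}\circ g,\,S),$$ where $(\tau_{\mathbf{V}}\circ g)(\mathbf{Z})=g\mathbf{Z}+\mathbf{V}$ for $\mathbf{Z}\in L(W,V)$, is a group isomorphism. That is, the generalized Jacobi group coincides with the generalized quantomorphism group (generalized ILM central extension) of $L(W,V)$.
   Context: $L(W,V)$ is the space of linear maps $W\to V$, i.e. $2k\times d$ matrices; $\operatorname{Sym}(W)$ is the space of symmetric bilinear forms on $W$ (symmetric $d\times d$ matrices); $M^{\rm sym}=\frac12(M+M^T)$; $\Omega$ also denotes the matrix of the symplectic form. $\Omega^W$ is the constant closed $\operatorname{Sym}(W)$-valued 2-form on $L(W,V)$ given by $\Omega^W(A,B)=(A^T\Omega B)^{\rm sym}$. Writing $\mathbf{Z}=(\mathbf{Q},\mathbf{P})$ in Darboux coordinates ($\mathbf{Q},\mathbf{P}$ are $k\times d$ matrices), it is exact, $\Omega^W=\mathbf{d}\alpha^W$ with $\alpha^W(\mathbf{Q},\mathbf{P})(\dot{\mathbf{Q}},\dot{\mathbf{P}})=\frac12(\mathbf{Q}^T\dot{\mathbf{P}}-\mathbf{P}^T\dot{\mathbf{Q}})^{\rm sym}$. $\operatorname{Diff}(L(W,V),\Omega^W)$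 denotes the connected component of the identity of the group of diffeomorphisms $\eta$ of $L(W,V)$ with $\eta^*\Omega^W=\Omega^W$ (i.e. those connected to the identity by a smooth path of such diffeomorphisms). The central extension $\operatorname{Diff}(L(W,V),\Omega^W)\times_B\operatorname{Sym}(W)$ has multiplication $(\eta_1,S_1)(\eta_2,S_2)=(\eta_1\circ\eta_2,S_1+S_2+B(\eta_1,\eta_2))$ with $B(\eta_1,\eta_2)=\int_0^{\eta_2(0)}(\eta_1^*\alpha^W-\alpha^W)$, the integral being along any smooth curve from $0$ to $\eta_2(0)$. The generalized Jacobi group is $\operatorname{Jac}(V,\Omega;W)=\operatorname{Sp}(V,\Omega)\times L(W,V)\times\operatorname{Sym}(W)$ with multiplication $(g,\mathcal{A},\mathcal{B})(g',\mathcal{A}',\mathcal{B}')=(gg',\mathcal{A}+g\mathcal{A}',\mathcal{B}+\mathcal{B}'+\frac12(\mathcal{A}^T\Omega g\mathcal{A}')^{\rm sym})$. *)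

theory Defs
  imports "HOL-Analysis.Analysis" "HOL-Algebra.Group"
begin

text \<open>\<open>V\<close> is \<open>real^('k + 'k)\<close>, where \<open>Inl i\<close> indexes the position
  coordinates and \<open>Inr i\<close> the momentum coordinates; \<open>W\<close> is \<open>real^'d\<close>.\<close>

type_synonym 'k endV = "real^('k + 'k)^('k + 'k)"
type_synonym ('d, 'k) linWV = "real^'d^('k + 'k)"
type_synonym 'd formW = "real^'d^'d"

subsection \<open>Linear algebra\<close>

definition Omega :: "'k::finite endV" where
  "Omega = (\<chi> a b. case (a, b) of
     (Inl i, Inr j) \<Rightarrow> (if i = j then 1 else 0)
   | (Inr i, Inl j) \<Rightarrow> (if i = j then -1 else 0)
   | _ \<Rightarrow> 0)"

definition Sp :: "('k::finite endV) set" where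
  "Sp = {g. transpose g ** Omega ** g = Omega}"

definition Sym :: "('d::finite formW) set" where
  "Sym = {S. transpose S = S}"

definition sym_part :: "'d::finite formW \<Rightarrow> 'd formW" where
  "sym_part M = (1/2) *\<^sub>R (M + transpose M)"

definition pos :: "('d::finite, 'k::finite) linWV \<Rightarrow> real^'d^'k" where
  "pos Z = (\<chi> i. Z $ Inl i)"

definition mom :: "('d::finite, 'k::finite) linWV \<Rightarrow> real^'d^'k" where
  "mom Z = (\<chi> i. Z $ Inr i)"

subsection \<open>Smooth maps and diffeomorphisms of Euclidean spaces\<close>

text \<open>A map between finite-dimensional spaces is of class \<open>C^(n+1)\<close> iff it is differentiable
  and all its directional derivatives are of class \<open>C^n\<close>.\<close>

primrec class_C :: "nat \<Rightarrow> ('a::euclidean_space \<Rightarrow> 'b::euclidean_space) \<Rightarrow> bool" where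
  "class_C 0 f \<longleftrightarrow> continuous_on UNIV f"
| "class_C (Suc n) f \<longleftrightarrow> (\<forall>x. f differentiable (at x)) \<and>
     (\<forall>v. class_C n (\<lambda>x. frechet_derivative f (at x) v))"

definition smooth :: "('a::euclidean_space \<Rightarrow> 'b::euclidean_space) \<Rightarrow> bool" where
  "smooth f \<longleftrightarrow> (\<forall>n. class_C n f)"

definition diffeomorphism :: "('a::euclidean_space \<Rightarrow> 'a) \<Rightarrow> bool" where
  "diffeomorphism \<eta> \<longleftrightarrow>
     smooth \<eta> \<and> (\<exists>\<theta>. smooth \<theta> \<and> \<theta> \<circ> \<eta> = id \<and> \<eta> \<circ> \<theta> = id)"

subsection \<open>Vector-valued differential forms\<close>

text \<open>A 1-form takes a point and one tangent vector, a 2-form a point and two tangent vectors.\<close>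

definition pullback1 ::
  "('a::euclidean_space \<Rightarrow> 'a) \<Rightarrow> ('a \<Rightarrow> 'a \<Rightarrow> 'c) \<Rightarrow> 'a \<Rightarrow> 'a \<Rightarrow> 'c" where
  "pullback1 \<eta> \<beta> Z A = \<beta> (\<eta> Z) (frechet_derivative \<eta> (at Z) A)"

definition pullback2 ::
  "('a::euclidean_space \<Rightarrow> 'a) \<Rightarrow> ('a \<Rightarrow> 'a \<Rightarrow> 'a \<Rightarrow> 'c) \<Rightarrow> 'a \<Rightarrow> 'a \<Rightarrow> 'a \<Rightarrow> 'c" where
  "pullback2 \<eta> \<omega> Z A B =
     \<omega> (\<eta> Z) (frechet_derivative \<eta> (at Z) A) (frechet_derivative \<eta> (at Z) B)"

definition has_line_integral ::
  "('a::euclidean_space \<Rightarrow> 'a \<Rightarrow> 'c::euclidean_space) \<Rightarrow> (real \<Rightarrow> 'a) \<Rightarrow> 'c \<Rightarrow> bool" where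
  "has_line_integral \<beta> \<gamma> I \<longleftrightarrow>
     ((\<lambda>t. \<beta> (\<gamma> t) (vector_derivative \<gamma> (at t))) has_integral I) {0..1}"

text \<open>The common value of the line integrals along all smooth curves from \<open>a\<close> to \<open>b\<close>;
  meaningful for closed \<open>\<beta>\<close> only.\<close>

definition integral_between ::
  "('a::euclidean_space \<Rightarrow> 'a \<Rightarrow> 'c::euclidean_space) \<Rightarrow> 'a \<Rightarrow> 'a \<Rightarrow> 'c" where
  "integral_between \<beta> a b =
     (THE I. \<forall>\<gamma>. smooth \<gamma> \<and> \<gamma> 0 = a \<and> \<gamma> 1 = b \<longrightarrow> has_line_integral \<beta> \<gamma> I)"

definition OmegaW ::
  "('d::finite, 'k::finite) linWV \<Rightarrow> ('d, 'k) linWV \<Rightarrow> ('d, 'k) linWV \<Rightarrow> 'd formW" where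
  "OmegaW Z A B = sym_part (transpose A ** Omega ** B)"

definition alphaW ::
  "('d::finite, 'k::finite) linWV \<Rightarrow> ('d, 'k) linWV \<Rightarrow> 'd formW" where
  "alphaW Z A =
     (1/2) *\<^sub>R sym_part (transpose (pos Z) ** mom A - transpose (mom Z) ** pos A)"

subsection \<open>The central extension of the diffeomorphism group\<close>

definition preserving_diffeos :: "(('d::finite, 'k::finite) linWV \<Rightarrow> ('d, 'k) linWV) set" where
  "preserving_diffeos = {\<eta>. diffeomorphism \<eta> \<and> pullback2 \<eta> OmegaW = OmegaW}"

text \<open>The identity component. A smooth path of diffeomorphisms is one that is jointly smooth in
  time and space; only its restriction to times in \<open>{0..1}\<close> matters, smoothness up to the
  end points being expressed by extendability to all times.\<close>

definition Diff_OmegaW :: "(('d::finite, 'k::finite) linWV \<Rightarrow> ('d, 'k) linWV) set" where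
  "Diff_OmegaW = {\<eta>. \<exists>H :: real \<Rightarrow> ('d, 'k) linWV \<Rightarrow> ('d, 'k) linWV.
     smooth (\<lambda>(t, Z). H t Z) \<and> (\<forall>t\<in>{0..1}. H t \<in> preserving_diffeos) \<and>
     H 0 = id \<and> H 1 = \<eta>}"

definition cocycle_B ::
  "(('d::finite, 'k::finite) linWV \<Rightarrow> ('d, 'k) linWV) \<Rightarrow>
   (('d, 'k) linWV \<Rightarrow> ('d, 'k) linWV) \<Rightarrow> 'd formW" where
  "cocycle_B \<eta>\<^sub>1 \<eta>\<^sub>2 =
     integral_between (\<lambda>Z A. pullback1 \<eta>\<^sub>1 alphaW Z A - alphaW Z A) 0 (\<eta>\<^sub>2 0)"

definition quantomorphism_group ::
  "((('d::finite, 'k::finite) linWV \<Rightarrow> ('d, 'k) linWV) \<times> 'd formW) monoid" where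
  "quantomorphism_group =
     \<lparr>carrier = Diff_OmegaW \<times> Sym,
      mult = (\<lambda>(\<eta>\<^sub>1, S\<^sub>1) (\<eta>\<^sub>2, S\<^sub>2). (\<eta>\<^sub>1 \<circ> \<eta>\<^sub>2, S\<^sub>1 + S\<^sub>2 + cocycle_B \<eta>\<^sub>1 \<eta>\<^sub>2)),
      one = (id, 0)\<rparr>"

subsection \<open>The generalized Jacobi group\<close>

definition jacobi_group ::
  "('k::finite endV \<times> ('d::finite, 'k) linWV \<times> 'd formW) monoid" where
  "jacobi_group =
     \<lparr>carrier = Sp \<times> UNIV \<times> Sym,
      mult = (\<lambda>(g, A, S) (g', A', S').
        (g ** g', A + g ** A',
         S + S' + (1/2) *\<^sub>R sym_part (transpose A ** Omega ** g ** A'))),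
      one = (mat 1, 0, 0)\<rparr>"

end

theory Submission imports Defs begin

text \<open>Evaluated on columns, a linear isometry \<open>L\<close> of \<open>OmegaW\<close> preserves the symplectic pairing of
  the \<open>i\<close>-th columns for every \<open>i\<close>, hence the kernel of that pairing, so the \<open>i\<close>-th column of
  \<open>L A\<close> depends on the \<open>i\<close>-th column of \<open>A\<close> alone; the off-diagonal entries force the same
  symplectic matrix on all columns. For a form-preserving \<open>\<eta>\<close>, the derivative at \<open>Z\<close> is thus
  \<open>A \<mapsto> G Z ** A\<close>, and the \<open>i\<close>-th column of \<open>\<eta> Z\<close>, hence also \<open>G Z\<close>, depends on the \<open>i\<close>-th
  column of \<open>Z\<close> alone. With at least two columns \<open>G\<close> is constant and \<open>\<eta>\<close> is affine.
  Conversely, affine symplectic maps lie in the identity component because \<open>Sp\<close> is generated by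
  transvections, each of which lies on a one-parameter subgroup.\<close>

section \<open>Smooth maps\<close>

text \<open>\<open>frechet_derivative\<close> is a chosen value; uniqueness of the derivative lets
  any explicit one replace it in the recursion.\<close>

lemma class_C_SucI:
  fixes f :: "'a::euclidean_space \<Rightarrow> 'b::euclidean_space"
  assumes "\<And>x. (f has_derivative f' x) (at x)" "\<And>v. class_C n (\<lambda>x. f' x v)"
  shows "class_C (Suc n) f"
proof -
  have "frechet_derivative f (at x) = f' x" for x
    using frechet_derivative_at[OF assms(1)[of x]] by simp
  then show ?thesis
    using assms by (auto simp: differentiable_def)
qed

lemma class_C_SucD:
  assumes "class_C (Suc n) f"
  shows "(f has_derivative frechet_derivative f (at x)) (at x)"
    and "class_C n (\<lambda>x. frechet_derivative f (at x) v)"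
  using assms by (auto simp: frechet_derivative_works)

lemma class_C_imp_continuous: "class_C n f \<Longrightarrow> continuous_on UNIV f"
  by (cases n) (auto intro!: differentiable_imp_continuous_on simp: differentiable_on_def)

lemma class_C_Suc_imp: "class_C (Suc n) f \<Longrightarrow> class_C n f"
proof (induction n arbitrary: f)
  case 0
  then show ?case using class_C_imp_continuous[of 1 f] by simp
next
  case (Suc n)
  then show ?case using class_C.simps(2) by metis
qed

lemma class_C_const: "class_C n (\<lambda>x. c)"
proof (induction n arbitrary: c)
  case (Suc n)
  then show ?case by (intro class_C_SucI[where f' = "\<lambda>x v. 0"]) auto
qed auto

lemma class_C_linear: "bounded_linear f \<Longrightarrow> class_C n f"
proof (cases n)
  case (Suc m)
  assume "bounded_linear f"
  then show ?thesis
    unfolding Suc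
    by (intro class_C_SucI[where f' = "\<lambda>x. f"] bounded_linear_imp_has_derivative class_C_const)
qed (auto simp: linear_continuous_on)

lemma class_C_add: "class_C n f \<Longrightarrow> class_C n g \<Longrightarrow> class_C n (\<lambda>x. f x + g x)"
proof (induction n arbitrary: f g)
  case (Suc n)
  note D = class_C_SucD[OF Suc.prems(1)] class_C_SucD[OF Suc.prems(2)]
  show ?case
    by (rule class_C_SucI[OF has_derivative_add[OF D(1,3)] Suc.IH[OF D(2,4)]])
qed (auto intro: continuous_intros)

lemma class_C_bilinear:
  assumes "bounded_bilinear B"
  shows "class_C n f \<Longrightarrow> class_C n g \<Longrightarrow> class_C n (\<lambda>x. B (f x) (g x))"
proof (induction n arbitrary: f g)
  case 0
  then show ?case using bounded_bilinear.continuous_on[OF assms] by auto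
next
  case (Suc n)
  note D = class_C_SucD[OF Suc.prems(1)] class_C_SucD[OF Suc.prems(2)]
  \<comment> \<open>In each term of the product rule one factor stays undifferentiated and must be
    lowered to class \<open>n\<close> for the induction hypothesis.\<close>
  note D0 = class_C_Suc_imp[OF Suc.prems(1)] class_C_Suc_imp[OF Suc.prems(2)]
  show ?case
    by (rule class_C_SucI[OF bounded_bilinear.FDERIV[OF assms D(1,3)]])
      (intro class_C_add Suc.IH D D0)
qed

text \<open>The direction \<open>L v\<close> does not vary with the point, so the derivative has the
  same shape and the induction closes.\<close>

lemma class_C_compose_linear:
  assumes "bounded_linear L"
  shows "class_C n f \<Longrightarrow> class_C n (\<lambda>x. f (L x))"
proof (induction n arbitrary: f)
  case 0
  then show ?case
    using continuous_on_compose2[OF _ linear_continuous_on[OF assms]] by auto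
next
  case (Suc n)
  note D = class_C_SucD[OF Suc.prems]
  show ?case
    by (rule class_C_SucI[OF has_derivative_compose[OF bounded_linear_imp_has_derivative[OF assms] D(1)]
          Suc.IH[OF D(2)]])
qed

lemma smooth_const: "smooth (\<lambda>x. c)"
  and smooth_linear: "bounded_linear f \<Longrightarrow> smooth f"
  and smooth_add: "smooth g \<Longrightarrow> smooth h \<Longrightarrow> smooth (\<lambda>x. g x + h x)"
  and smooth_compose_linear: "smooth k \<Longrightarrow> bounded_linear L \<Longrightarrow> smooth (\<lambda>x. k (L x))"
  and smooth_bilinear:
    "bounded_bilinear B \<Longrightarrow> smooth p \<Longrightarrow> smooth q \<Longrightarrow> smooth (\<lambda>x. B (p x) (q x))"
  unfolding smooth_def
  using class_C_const class_C_linear class_C_add class_C_compose_linear class_C_bilinear by blast+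

lemma smooth_has_derivative:
  "smooth f \<Longrightarrow> (f has_derivative frechet_derivative f (at x)) (at x)"
  unfolding smooth_def using class_C_SucD(1) by blast

lemma bounded_bilinear_matrix_matrix_mult:
  "bounded_bilinear ((**) :: real^'n::finite^'m::finite \<Rightarrow> real^'p::finite^'n \<Rightarrow> real^'p^'m)"
  unfolding bilinear_conv_bounded_bilinear[symmetric] bilinear_def
  by (auto intro!: linearI simp: vec_eq_iff matrix_matrix_mult_def sum.distrib algebra_simps sum_distrib_left)

interpretation matmul: bounded_bilinear
  "(**) :: real^'n::finite^'m::finite \<Rightarrow> real^'p::finite^'n \<Rightarrow> real^'p^'m"
  by (rule bounded_bilinear_matrix_matrix_mult)

section \<open>The symplectic group\<close>

definition sympl :: "real^('k::finite + 'k) \<Rightarrow> real^('k + 'k) \<Rightarrow> real" where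
  "sympl u v = u \<bullet> (Omega *v v)"

lemma sympl_explicit:
  fixes u v :: "real^('k::finite + 'k)"
  shows "sympl u v = (\<Sum>i\<in>UNIV. u $ Inl i * v $ Inr i - u $ Inr i * v $ Inl i)"
proof -
  have S: "(\<Sum>a\<in>UNIV. f a) = (\<Sum>i\<in>UNIV. f (Inl i)) + (\<Sum>i\<in>UNIV. f (Inr i))"
    for f :: "'k + 'k \<Rightarrow> real"
    by (subst UNIV_sum, subst sum.union_disjoint) (auto simp: sum.reindex)
  show ?thesis
    unfolding sympl_def inner_vec_def S
    by (simp add: matrix_vector_mult_def Omega_def S if_distrib[of "\<lambda>x. x * _"] cong: if_cong)
       (simp add: sum_subtractf sum_negf)
qed

lemma sympl_bilinear:
  "sympl (u + u') v = sympl u v + sympl u' v" "sympl u (v + v') = sympl u v + sympl u v'"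
  "sympl (u - u') v = sympl u v - sympl u' v" "sympl u (v - v') = sympl u v - sympl u v'"
  "sympl (c *\<^sub>R u) v = c * sympl u v" "sympl u (c *\<^sub>R v) = c * sympl u v"
  "sympl (- u) v = - sympl u v" "sympl u (- v) = - sympl u v"
  "sympl 0 v = 0" "sympl u 0 = 0"
  by (simp_all add: sympl_def inner_left_distrib inner_right_distrib matrix_vector_right_distrib
      inner_diff_left inner_diff_right matrix_vector_mult_diff_distrib matrix_vector_mult_scaleR
      vec.neg)

lemma sympl_commute: "sympl u v = - sympl v u"
  by (simp add: sympl_explicit sum_negf[symmetric] algebra_simps)

lemma sympl_self [simp]: "sympl u u = 0"
  using sympl_commute[of u u] by simp

lemma sympl_axis [simp]:
  "sympl u (axis (Inl i) 1) = - u $ Inr i" "sympl u (axis (Inr i) 1) = u $ Inl i"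
  by (simp_all add: sympl_explicit axis_def if_distrib[of "\<lambda>x. _ * x"] sum_negf cong: if_cong)

text \<open>Pairings with the axis vectors are, up to sign, the coordinates of
  \<open>u\<close>.\<close>

lemma sympl_nondegenerate: "(\<And>v. sympl u v = 0) \<Longrightarrow> u = 0"
  unfolding vec_eq_iff zero_index
  by (metis sympl_axis neg_equal_0_iff_equal sumE)

lemma Sp_iff: "g \<in> Sp \<longleftrightarrow> (\<forall>u v. sympl (g *v u) (g *v v) = sympl u v)"
proof -
  have E: "sympl (g *v u) (g *v v) = u \<bullet> ((transpose g ** Omega ** g) *v v)" for u v
    by (simp add: sympl_def matrix_vector_mul_assoc[symmetric] inner_commute[of u] dot_lmul_matrix)
      (simp add: inner_commute)
  show ?thesis
  proof
    assume "\<forall>u v. sympl (g *v u) (g *v v) = sympl u v"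
    then have "u \<bullet> ((transpose g ** Omega ** g) *v v - Omega *v v) = 0" for u v
      unfolding E by (simp add: sympl_def inner_diff_right)
    then have "(transpose g ** Omega ** g) *v v - Omega *v v = 0" for v
      by (metis inner_eq_zero_iff)
    then show "g \<in> Sp" by (simp add: Sp_def matrix_eq)
  qed (unfold E, simp add: Sp_def sympl_def)
qed

lemma Sp_preserves: "g \<in> Sp \<Longrightarrow> sympl (g *v u) (g *v v) = sympl u v"
  by (simp add: Sp_iff)

lemma Sp_one: "mat 1 \<in> Sp"
  by (simp add: Sp_iff)

lemma Sp_mult: "g \<in> Sp \<Longrightarrow> h \<in> Sp \<Longrightarrow> g ** h \<in> Sp"
  by (simp add: Sp_iff matrix_vector_mul_assoc[symmetric])

text \<open>By invariance a kernel vector pairs to zero with everything, so nondegeneracy makes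
  \<open>g\<close> injective; square matrices then have two-sided inverses.\<close>

lemma Sp_inverse:
  assumes "g \<in> Sp"
  obtains h where "h \<in> Sp" "h ** g = mat 1" "g ** h = mat 1"
proof -
  have "v = 0" if "g *v v = 0" for v
    using that Sp_preserves[OF assms, of v] by (intro sympl_nondegenerate) (metis sympl_bilinear(9))
  then have "inj ((*v) g)"
    by (simp add: linear_injective_0)
  then obtain h where h: "h ** g = mat 1"
    using matrix_left_invertible_injective[of g] by auto
  then have gh: "g ** h = mat 1" by (simp add: matrix_left_right_inverse)
  have "sympl (h *v u) (h *v v) = sympl u v" for u v
    using Sp_preserves[OF assms, of "h *v u" "h *v v"] by (simp add: matrix_vector_mul_assoc gh)
  then show ?thesis using that h gh by (auto simp: Sp_iff)
qed

section \<open>Transvections and smooth paths in the symplectic group\<close>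

text \<open>For fixed \<open>v\<close> this is a one-parameter group in \<open>c\<close>, because
  \<open>sympl v v = 0\<close>; being affine in \<open>c\<close>, it is visibly smooth.\<close>

definition transvection :: "real \<Rightarrow> real^('k::finite + 'k) \<Rightarrow> 'k endV" where
  "transvection c v = mat 1 + c *\<^sub>R matrix (\<lambda>x. sympl v x *\<^sub>R v)"

lemma transvection_apply: "transvection c v *v x = x + (c * sympl v x) *\<^sub>R v"
proof -
  have "linear (\<lambda>x. sympl v x *\<^sub>R v)"
    by (intro linearI) (auto simp: sympl_bilinear algebra_simps)
  then show ?thesis
    by (simp add: transvection_def matrix_vector_mult_add_rdistrib matrix_works
        scaleR_matrix_vector_assoc[symmetric])
qed

text \<open>The two terms linear in \<open>c\<close> cancel by antisymmetry, and the quadratic one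
  contains \<open>sympl v v = 0\<close>.\<close>

lemma transvection_Sp: "transvection c v \<in> Sp"
  unfolding Sp_iff transvection_apply
  by (simp add: sympl_bilinear sympl_commute[of _ v])

lemma transvection_inverse: "transvection (- c) v ** transvection c v = mat 1"
  by (simp add: matrix_eq matrix_vector_mul_assoc[symmetric] transvection_apply sympl_bilinear
      algebra_simps)

text \<open>Shaped like the paths in \<open>Diff_OmegaW\<close>: smooth for all times, constrained
  on \<open>{0..1}\<close> alone.\<close>

definition Sp_reachable :: "'k::finite endV \<Rightarrow> bool" where
  "Sp_reachable g \<longleftrightarrow>
    (\<exists>\<gamma>. smooth \<gamma> \<and> (\<forall>t\<in>{0..1}. \<gamma> t \<in> Sp) \<and> \<gamma> (0::real) = mat 1 \<and> \<gamma> 1 = g)"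

lemma Sp_reachable_one: "Sp_reachable (mat 1)"
  unfolding Sp_reachable_def
  by (intro exI[of _ "\<lambda>t. mat 1"]) (simp add: Sp_one smooth_const)

text \<open>The paths are multiplied pointwise; concatenating them could break smoothness at the
  junction.\<close>

lemma Sp_reachable_mult:
  assumes "Sp_reachable g" "Sp_reachable h"
  shows "Sp_reachable (g ** h)"
proof -
  obtain \<gamma> \<delta> where "smooth \<gamma>" "\<forall>t\<in>{0..1}. \<gamma> t \<in> Sp" "\<gamma> (0::real) = mat 1" "\<gamma> 1 = g"
    "smooth \<delta>" "\<forall>t\<in>{0..1}. \<delta> t \<in> Sp" "\<delta> (0::real) = mat 1" "\<delta> 1 = h"
    using assms unfolding Sp_reachable_def by auto
  then show ?thesis unfolding Sp_reachable_def
    by (intro exI[of _ "\<lambda>t. \<gamma> t ** \<delta> t"])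
      (auto simp: Sp_mult smooth_bilinear[OF bounded_bilinear_matrix_matrix_mult])
qed

lemma Sp_reachable_transvection: "Sp_reachable (transvection c v)"
  unfolding Sp_reachable_def
proof (intro exI[of _ "\<lambda>t. transvection (t * c) v"] conjI)
  show "smooth (\<lambda>t. transvection (t * c) v)"
    unfolding transvection_def
    by (intro smooth_add smooth_const smooth_linear bounded_linear_intros)
qed (simp_all add: transvection_Sp, simp add: transvection_def)

text \<open>Restricting the directions to \<open>U\<close> ensures that all vectors symplectically
  orthogonal to \<open>U\<close> stay fixed.\<close>

inductive_set transv_gen :: "(real^('k::finite + 'k)) set \<Rightarrow> ('k endV) set" for U where
  one: "mat 1 \<in> transv_gen U"
| step: "h \<in> transv_gen U \<Longrightarrow> v \<in> U \<Longrightarrow> transvection c v ** h \<in> transv_gen U"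

lemma transvection_in_gen: "v \<in> U \<Longrightarrow> transvection c v \<in> transv_gen U"
  using transv_gen.step[OF transv_gen.one, of v U c] by simp

lemma transv_gen_mult: "h \<in> transv_gen U \<Longrightarrow> k \<in> transv_gen U \<Longrightarrow> h ** k \<in> transv_gen U"
  by (induction rule: transv_gen.induct)
    (auto simp: matrix_mul_assoc[symmetric] intro: transv_gen.intros)

lemma transv_gen_Sp: "h \<in> transv_gen U \<Longrightarrow> h \<in> Sp"
  by (induction rule: transv_gen.induct) (auto intro: Sp_one Sp_mult transvection_Sp)

lemma transv_gen_fixes:
  "h \<in> transv_gen U \<Longrightarrow> (\<And>v. v \<in> U \<Longrightarrow> sympl v x = 0) \<Longrightarrow> h *v x = x"
  by (induction rule: transv_gen.induct)
    (auto simp: matrix_vector_mul_assoc[symmetric] transvection_apply)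

text \<open>The factors of \<open>h\<close> are peeled off from the left by inverse transvections,
  which are themselves reachable.\<close>

lemma Sp_reachable_cancel:
  "h \<in> transv_gen U \<Longrightarrow> Sp_reachable (h ** g) \<Longrightarrow> Sp_reachable g"
proof (induction arbitrary: g rule: transv_gen.induct)
  case (step h v c)
  have "transvection (- c) v ** (transvection c v ** h ** g) = h ** g"
    by (simp add: matrix_mul_assoc transvection_inverse)
  then have "Sp_reachable (h ** g)"
    using Sp_reachable_mult[OF Sp_reachable_transvection[of "- c" v] step.prems] by simp
  then show ?case by (rule step.IH)
qed simp

section \<open>Moving vectors by transvections\<close>

text \<open>A transvection shifts along its direction, which must therefore be \<open>w - v\<close>;
  the coefficient normalises \<open>sympl (w - v) v = sympl w v\<close>.\<close>

lemma transvection_moves: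
  assumes "sympl v w \<noteq> 0"
  shows "transvection (1 / sympl w v) (w - v) *v v = w"
  using assms sympl_commute[of v w] by (simp add: transvection_apply sympl_bilinear)

text \<open>One transvection suffices when \<open>v\<close> and \<open>w\<close> pair nontrivially.
  In general the route passes through some \<open>u\<close> that pairs nontrivially with
  both.\<close>

lemma transv_gen_moves_vector:
  assumes U: "subspace U" "\<And>u. u \<in> U \<Longrightarrow> u \<noteq> 0 \<Longrightarrow> \<exists>x\<in>U. sympl u x \<noteq> 0"
    and vw: "v \<in> U" "w \<in> U" "v \<noteq> 0" "w \<noteq> 0"
  obtains h where "h \<in> transv_gen U" "h *v v = w"
proof -
  obtain x y where xy: "x \<in> U" "sympl v x \<noteq> 0" "y \<in> U" "sympl w y \<noteq> 0"
    using U(2) vw by meson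
  obtain u where u: "u \<in> U" "sympl v u \<noteq> 0" "sympl w u \<noteq> 0"
  \<comment> \<open>If neither \<open>x\<close> nor \<open>y\<close> serves for both vectors, then
    \<open>sympl w x = 0\<close> and \<open>sympl v y = 0\<close>, so \<open>x + y\<close>
    does.\<close>
  proof (cases "sympl w x \<noteq> 0 \<or> sympl v y \<noteq> 0")
    case True
    then show ?thesis using xy that by blast
  next
    case False
    then show ?thesis
      using xy that[of "x + y"] subspace_add[OF U(1)] by (auto simp: sympl_bilinear)
  qed
  let ?h = "transvection (1 / sympl w u) (w - u) ** transvection (1 / sympl u v) (u - v)"
  have "sympl u w \<noteq> 0" using u(3) sympl_commute[of u w] by simp
  then have "?h *v v = w"
    by (simp add: matrix_vector_mul_assoc[symmetric] transvection_moves u)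
  moreover have "?h \<in> transv_gen U"
    using u vw U(1) by (intro transv_gen_mult transvection_in_gen subspace_diff)
  ultimately show ?thesis using that by blast
qed

text \<open>Since \<open>v\<close> and \<open>w\<close> have the same pairing with \<open>e\<close>,
  the direction \<open>w - v\<close> is orthogonal to \<open>e\<close>, and the transvection fixes
  \<open>e\<close>.\<close>

lemma transv_gen_moves_partner:
  assumes U: "subspace U" and in_U: "e \<in> U" "v \<in> U" "w \<in> U"
    and e: "sympl e v = 1" "sympl e w = 1"
  obtains h where "h \<in> transv_gen U" "h *v e = e" "h *v v = w"
proof -
  have step: "\<exists>h \<in> transv_gen U. h *v e = e \<and> h *v v = w"
    if "v \<in> U" "w \<in> U" "sympl e v = 1" "sympl e w = 1" "sympl v w \<noteq> 0" for v w
  proof (intro bexI conjI)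
    show "transvection (1 / sympl w v) (w - v) *v e = e"
      using that sympl_commute[of v e] sympl_commute[of w e]
      by (simp add: transvection_apply sympl_bilinear)
  qed (use that U transvection_moves in \<open>auto intro!: transvection_in_gen subspace_diff\<close>)
  show ?thesis
  proof (cases "sympl v w = 0")
    case False
    then show ?thesis using step in_U e that by blast
  next
    case True
    \<comment> \<open>The detour through \<open>e + v\<close> works: it pairs to 1 with
      \<open>e\<close> on the left, and \<open>sympl v (e + v) = -1\<close>,
      \<open>sympl (e + v) w = 1\<close>.\<close>
    obtain h where h: "h \<in> transv_gen U" "h *v e = e" "h *v v = e + v"
      using step[of v "e + v"] in_U e U sympl_commute[of v e]
      by (auto simp: sympl_bilinear subspace_add)
    obtain k where k: "k \<in> transv_gen U" "k *v e = e" "k *v (e + v) = w"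
      using step[of "e + v" w] in_U e U True
      by (auto simp: sympl_bilinear subspace_add)
    show ?thesis
      by (rule that[of "k ** h"])
        (use h k in \<open>simp_all add: transv_gen_mult matrix_vector_mul_assoc[symmetric]\<close>)
  qed
qed

section \<open>Path-connectedness of the symplectic group\<close>

abbreviation fixes_plane :: "'k::finite endV \<Rightarrow> 'k \<Rightarrow> bool" where
  "fixes_plane g i \<equiv> g *v axis (Inl i) 1 = axis (Inl i) 1 \<and> g *v axis (Inr i) 1 = axis (Inr i) 1"

text \<open>Induction on the planes that may still move: left multiplication by transvections makes
  \<open>g\<close> fix the plane of \<open>j\<close> as well, without disturbing those already
  fixed.\<close>

lemma Sp_reachable_if_fixes_planes:
  fixes g :: "'k::finite endV"
  assumes "finite I" "g \<in> Sp" "\<And>i. i \<notin> I \<Longrightarrow> fixes_plane g i"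
  shows "Sp_reachable g"
  using assms
proof (induction I arbitrary: g rule: finite_induct)
  case empty
  have "g *v axis a 1 = mat 1 *v axis a 1" for a
    using empty.prems(2) by (cases a) auto
  then have "g = mat 1"
    unfolding matrix_vector_mult_basis vec_eq_iff column_def by simp
  then show ?case by (simp add: Sp_reachable_one)
next
  case (insert j I)
  \<comment> \<open>The span of the planes that may still move; the remaining planes are
    symplectically orthogonal to it.\<close>
  define U :: "(real^('k + 'k)) set"
    where "U = {u. \<forall>i. i \<notin> insert j I \<longrightarrow> u $ Inl i = 0 \<and> u $ Inr i = 0}"
  let ?e = "axis (Inl j) 1 :: real^('k + 'k)" and ?f = "axis (Inr j) 1 :: real^('k + 'k)"
  have U: "subspace U"
    by (auto simp: subspace_def U_def)
  have ef: "?e \<in> U" "?f \<in> U"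
    by (auto simp: U_def axis_def)
  have nondeg: "\<exists>x\<in>U. sympl u x \<noteq> 0" if "u \<in> U" "u \<noteq> 0" for u
  proof -
    obtain a where a: "u $ a \<noteq> 0" using \<open>u \<noteq> 0\<close> by (auto simp: vec_eq_iff)
    show ?thesis
    proof (cases a)
      case (Inl i)
      then have "axis (Inr i) 1 \<in> U" using a that(1) by (auto simp: U_def axis_def)
      then show ?thesis using a Inl by (intro bexI) auto
    next
      case (Inr i)
      then have "axis (Inl i) 1 \<in> U" using a that(1) by (auto simp: U_def axis_def)
      then show ?thesis using a Inr by (intro bexI) auto
    qed
  qed
  have fixes_outside: "fixes_plane (h ** k) i"
    if "h \<in> transv_gen U" "fixes_plane k i" "i \<notin> insert j I" for h k i
    using that by (auto simp: matrix_vector_mul_assoc[symmetric] U_def intro: transv_gen_fixes)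
  \<comment> \<open>The outer coordinates of \<open>k *v u\<close> are, up to sign, pairings with
    axis vectors fixed by \<open>k\<close>, so they agree with those of \<open>u\<close> and
    vanish.\<close>
  have preserves_U: "k *v u \<in> U"
    if k: "k \<in> Sp" "\<And>i. i \<notin> insert j I \<Longrightarrow> fixes_plane k i" and u: "u \<in> U" for k u
  proof -
    have "(k *v u) $ Inl i = 0 \<and> (k *v u) $ Inr i = 0" if i: "i \<notin> insert j I" for i
      using Sp_preserves[OF k(1), of u "axis (Inr i) 1"] Sp_preserves[OF k(1), of u "axis (Inl i) 1"]
        k(2)[OF i] u i by (simp add: U_def)
    then show ?thesis by (simp add: U_def)
  qed
  have "sympl (g *v ?e) (g *v ?f) = 1"
    using Sp_preserves[OF insert.prems(1), of ?e ?f] by simp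
  then have "g *v ?e \<noteq> 0" by (auto simp: sympl_bilinear)
  moreover have "?e \<noteq> 0" by simp
  ultimately obtain h where h: "h \<in> transv_gen U" "h *v (g *v ?e) = ?e"
    using transv_gen_moves_vector[OF U nondeg preserves_U[OF insert.prems ef(1)] ef(1)] by blast
  have hg: "h ** g \<in> Sp" "\<And>i. i \<notin> insert j I \<Longrightarrow> fixes_plane (h ** g) i"
    using insert.prems fixes_outside h transv_gen_Sp Sp_mult by blast+
  have hge: "(h ** g) *v ?e = ?e"
    using h(2) by (simp add: matrix_vector_mul_assoc)
  then have "sympl ?e ((h ** g) *v ?f) = 1"
    using Sp_preserves[OF hg(1), of ?e ?f] by simp
  moreover have "sympl ?e ?f = 1" by simp
  \<comment> \<open>\<open>?f\<close> and its image under \<open>h ** g\<close> both pair to 1 with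
    \<open>?e\<close>, so the image can be moved back while \<open>?e\<close> stays fixed.\<close>
  ultimately obtain k where k: "k \<in> transv_gen U" "k *v ?e = ?e" "k *v ((h ** g) *v ?f) = ?f"
    using transv_gen_moves_partner[OF U ef(1) preserves_U[OF hg ef(2)] ef(2)] by blast
  have "fixes_plane (k ** (h ** g)) i" if "i \<notin> I" for i
  proof (cases "i = j")
    case True
    then show ?thesis
      using k hge by (simp add: matrix_vector_mul_assoc[symmetric])
  next
    case False
    then show ?thesis using that hg(2) k(1) fixes_outside by blast
  qed
  then have "Sp_reachable (k ** (h ** g))"
    using insert.IH hg(1) k(1) transv_gen_Sp Sp_mult by blast
  then show ?case
    using Sp_reachable_cancel h(1) k(1) by blast
qed

text \<open>With every plane allowed to move, the fixing condition is vacuous.\<close>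

lemma Sp_reachable: "g \<in> Sp \<Longrightarrow> Sp_reachable g"
  using Sp_reachable_if_fixes_planes[of UNIV] by simp

section \<open>Linear maps preserving the matrix-valued form\<close>

lemma column_matrix_mult: "column i (g ** Z) = g *v column i Z"
  by (simp add: vec_eq_iff column_def matrix_matrix_mult_def matrix_vector_mult_def)

lemma linear_column: "linear (column i)"
  by (intro linearI) (simp_all add: vec_eq_iff column_def)

lemma matrix_eq_columnsI: "(\<And>i. column i A = column i B) \<Longrightarrow> A = B"
  by (simp add: vec_eq_iff column_def)

text \<open>A linear right inverse of \<open>column i\<close>, used to test a map on one column at a
  time.\<close>

definition single_column :: "'d::finite \<Rightarrow> real^'m::finite \<Rightarrow> real^'d^'m" where
  "single_column i u = (\<chi> a j. if j = i then u $ a else 0)"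

lemma column_single_column: "column j (single_column i u) = (if j = i then u else 0)"
  by (simp add: vec_eq_iff column_def single_column_def)

lemma linear_single_column: "linear (single_column i)"
  by (intro linearI) (simp_all add: vec_eq_iff single_column_def)

lemma pairing_entry: "(transpose A ** Omega ** B) $ i $ j = sympl (column i A) (column j B)"
proof -
  have "(transpose A ** Omega ** B) $ i $ j =
      (\<Sum>b\<in>UNIV. (\<Sum>a\<in>UNIV. A $ a $ i * Omega $ a $ b) * B $ b $ j)"
    by (simp add: matrix_matrix_mult_def transpose_def)
  also have "\<dots> = (\<Sum>a\<in>UNIV. \<Sum>b\<in>UNIV. A $ a $ i * Omega $ a $ b * B $ b $ j)"
    unfolding sum_distrib_right by (rule sum.swap)
  also have "\<dots> = sympl (column i A) (column j B)"
    by (simp add: sympl_def inner_vec_def matrix_vector_mult_def column_def sum_distrib_left mult.assoc)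
  finally show ?thesis .
qed

lemma OmegaW_entry:
  "OmegaW Z A B $ i $ j = (sympl (column i A) (column j B) + sympl (column j A) (column i B)) / 2"
  by (simp add: OmegaW_def sym_part_def transpose_def[of "_ ** _"] pairing_entry)

lemma linear_OmegaW_isometry:
  fixes L :: "('d::finite, 'k::finite) linWV \<Rightarrow> ('d, 'k) linWV"
  assumes L: "linear L" and isom: "\<And>A B. OmegaW Z' (L A) (L B) = OmegaW Z A B"
  obtains g where "g \<in> Sp" "\<And>A. L A = g ** A"
proof -
  have entry: "sympl (column i (L A)) (column j (L B)) + sympl (column j (L A)) (column i (L B)) =
      sympl (column i A) (column j B) + sympl (column j A) (column i B)" for A B i j
    using arg_cong[OF isom[of A B], of "\<lambda>M. M $ i $ j"] by (simp add: OmegaW_entry)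
  \<comment> \<open>On the diagonal the two summands of the entry coincide.\<close>
  have diag: "sympl (column i (L A)) (column i (L B)) = sympl (column i A) (column i B)" for A B i
    using entry[of i A i B] by simp
  have "A = 0" if "L A = 0" for A
  proof -
    have "column i A = 0" for i
    proof (rule sympl_nondegenerate)
      show "sympl (column i A) v = 0" for v
        using diag[of i A "single_column i v"] that
        by (simp add: column_single_column sympl_bilinear linear_0[OF linear_column])
    qed
    then show ?thesis by (intro matrix_eq_columnsI) (simp add: linear_0[OF linear_column])
  qed
  then have "inj L" using L by (simp add: linear_injective_0)
  then have surj: "surj L" by (rule linear_inj_imp_surj[OF L])
  \<comment> \<open>By \<open>diag\<close> and surjectivity, \<open>column i (L A)\<close> pairs to
    zero with every vector.\<close>
  have vanish: "column i (L A) = 0" if "column i A = 0" for i A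
  proof (rule sympl_nondegenerate)
    fix v
    obtain B where "L B = single_column i v" using surj by (metis surjD)
    then show "sympl (column i (L A)) v = 0"
      using diag[of i A B] that by (simp add: column_single_column sympl_bilinear)
  qed
  define f where "f = (\<lambda>i u. column i (L (single_column i u)))"
  \<comment> \<open>Subtracting the single-column part leaves a matrix with zero \<open>i\<close>-th
    column, to which \<open>vanish\<close> applies.\<close>
  have col: "column i (L A) = f i (column i A)" for i A
    using vanish[of i "A - single_column i (column i A)"]
    by (simp add: f_def linear_diff[OF L] linear_diff[OF linear_column] column_single_column)
  \<comment> \<open>For \<open>i \<noteq> j\<close> the second summand of \<open>entry\<close>
    vanishes on single-column matrices, leaving one pairing across different columns.\<close>
  have pres: "sympl (f i u) (f j v) = sympl u v" for i j u v
  proof (cases "i = j")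
    case False
    have "column j (L (single_column i u)) = 0"
      using False by (intro vanish) (simp add: column_single_column)
    then show ?thesis
      using entry[of i "single_column i u" j "single_column j v"] False
      by (simp add: f_def column_single_column sympl_bilinear)
  qed (use diag[of i "single_column i u" "single_column i v"] in
        \<open>simp add: f_def column_single_column\<close>)
  \<comment> \<open>\<open>f i u\<close> and \<open>f j u\<close> have equal pairings with the whole
    range of \<open>f i\<close>, which is all of \<open>V\<close>.\<close>
  have f_eq: "f i u = f j u" for i j u
  proof -
    have "f i u - f j u = 0"
    proof (rule sympl_nondegenerate)
      fix w
      obtain A where "L A = single_column i w" using surj by (metis surjD)
      then have "f i (column i A) = w" using col[of i A] by (simp add: column_single_column)
      then show "sympl (f i u - f j u) w = 0" using pres by (auto simp: sympl_bilinear)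
    qed
    then show ?thesis by simp
  qed
  \<comment> \<open>\<open>undefined\<close> is merely some column index; by \<open>f_eq\<close> all
    give the same map.\<close>
  define g where "g = matrix (f undefined)"
  have "linear (f i)" for i
    using linear_compose[OF linear_compose[OF linear_single_column L] linear_column]
    by (simp add: f_def o_def)
  then have g: "g *v u = f i u" for i u
    unfolding g_def using f_eq by (simp add: matrix_works)
  show ?thesis
  proof
    show "g \<in> Sp" by (simp add: Sp_iff g[where i = undefined] pres)
    show "L A = g ** A" for A
      by (intro matrix_eq_columnsI) (simp add: column_matrix_mult col flip: g)
  qed
qed

section \<open>Form-preserving diffeomorphisms\<close>

lemma affine_has_derivative:
  "((\<lambda>Z. g ** Z + V) has_derivative (\<lambda>A. g ** A)) (at Z)" for g :: "real^'n::finite^'m::finite"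
  by (auto intro!: derivative_eq_intros matmul.bounded_linear_right bounded_linear_imp_has_derivative)

lemma frechet_derivative_affine:
  "frechet_derivative (\<lambda>Z. g ** Z + V) (at Z) = (\<lambda>A. g ** A)" for g :: "real^'n::finite^'m::finite"
  using frechet_derivative_at[OF affine_has_derivative] by metis

lemma smooth_affine: "smooth (\<lambda>Z. g ** Z + V)" for g :: "real^'n::finite^'m::finite"
  by (intro smooth_add smooth_const smooth_linear matmul.bounded_linear_right)

lemma pairing_invariant:
  "g \<in> Sp \<Longrightarrow> transpose (g ** A) ** Omega ** (g ** B) = transpose A ** Omega ** B"
  by (simp add: vec_eq_iff pairing_entry column_matrix_mult Sp_preserves)

lemma affine_in_preserving_diffeos:
  assumes "g \<in> Sp"
  shows "(\<lambda>Z. g ** Z + V) \<in> preserving_diffeos"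
proof -
  obtain h where h: "h ** g = mat 1" "g ** h = mat 1"
    using Sp_inverse[OF assms] by blast
  have "diffeomorphism (\<lambda>Z. g ** Z + V)"
    unfolding diffeomorphism_def
    by (intro conjI smooth_affine exI[of _ "\<lambda>Z. h ** Z + - (h ** V)"])
      (auto simp: fun_eq_iff matrix_add_ldistrib matmul.diff_right matrix_mul_assoc h matmul.minus_right)
  moreover have "pullback2 (\<lambda>Z. g ** Z + V) OmegaW = OmegaW"
    by (simp add: fun_eq_iff pullback2_def frechet_derivative_affine OmegaW_def
        pairing_invariant[OF assms])
  ultimately show ?thesis by (simp add: preserving_diffeos_def)
qed

lemma preserving_diffeo_affine:
  fixes \<eta> :: "('d::finite, 'k::finite) linWV \<Rightarrow> ('d, 'k) linWV"
  assumes d: "CARD('d) \<ge> 2" and \<eta>: "\<eta> \<in> preserving_diffeos"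
  obtains g V where "g \<in> Sp" "\<eta> = (\<lambda>Z. g ** Z + V)"
proof -
  have deriv: "(\<eta> has_derivative frechet_derivative \<eta> (at Z)) (at Z)" for Z
    using \<eta> by (simp add: preserving_diffeos_def diffeomorphism_def smooth_has_derivative)
  have "OmegaW (\<eta> Z) (frechet_derivative \<eta> (at Z) A) (frechet_derivative \<eta> (at Z) B) = OmegaW Z A B"
    for Z A B
    using \<eta> by (simp add: preserving_diffeos_def pullback2_def fun_eq_iff)
  then have "\<exists>g\<in>Sp. \<forall>A. frechet_derivative \<eta> (at Z) A = g ** A" for Z
    using linear_OmegaW_isometry[OF has_derivative_linear[OF deriv[of Z]]] by metis
  then obtain G where G: "\<And>Z. G Z \<in> Sp" "\<And>Z A. frechet_derivative \<eta> (at Z) A = G Z ** A"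
    by metis
  have D: "(\<eta> has_derivative (\<lambda>A. G Z ** A)) (at Z)" for Z
    using deriv[of Z] G(2) by (metis (no_types, lifting) ext)
  have lin_col: "bounded_linear (column i :: ('d, 'k) linWV \<Rightarrow> _)" for i
    by (simp add: linear_column linear_linear)
  \<comment> \<open>Along the line in direction \<open>C\<close> the derivative of the
    \<open>i\<close>-th column is \<open>G\<close> applied to \<open>column i C = 0\<close>.\<close>
  have col_local: "column i (\<eta> (Z + C)) = column i (\<eta> Z)" if "column i C = 0" for i Z C
  proof -
    have "((\<lambda>t. Z + t *\<^sub>R C) has_derivative (\<lambda>t. t *\<^sub>R C)) (at t)" for t
      by (auto intro!: derivative_eq_intros)
    from has_derivative_compose[OF has_derivative_compose[OF this D]
        bounded_linear_imp_has_derivative[OF lin_col[of i]]]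
    have "((\<lambda>t. column i (\<eta> (Z + t *\<^sub>R C))) has_derivative (\<lambda>t. 0)) (at t within UNIV)" for t
      by (simp add: column_matrix_mult linear_scale[OF linear_column] that)
    from has_derivative_zero_constant[OF convex_UNIV this]
    obtain c where "\<And>t. column i (\<eta> (Z + t *\<^sub>R C)) = c" by blast
    from this[of 0] this[of 1] show ?thesis by simp
  qed
  \<comment> \<open>By \<open>col_local\<close>, translation by \<open>C\<close> leaves
    \<open>column i (\<eta> X)\<close> unchanged; comparing the two derivatives at \<open>Z\<close>
    gives the claim.\<close>
  have G_local: "G (Z + C) = G Z" if "column i C = 0" for i Z C
  proof -
    have "((\<lambda>X. X + C) has_derivative (\<lambda>A. A)) (at Z)"
      by (auto intro!: derivative_eq_intros)
    from has_derivative_compose[OF has_derivative_compose[OF this D]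
        bounded_linear_imp_has_derivative[OF lin_col[of i]]]
    have "((\<lambda>X. column i (\<eta> X)) has_derivative (\<lambda>A. column i (G (Z + C) ** A))) (at Z)"
      by (simp add: col_local[OF that])
    from has_derivative_unique[OF this has_derivative_compose[OF D
          bounded_linear_imp_has_derivative[OF lin_col[of i]]]]
    have "G (Z + C) *v column i A = G Z *v column i A" for A
      by (simp add: column_matrix_mult fun_eq_iff)
    from this[of "single_column i u" for u] show ?thesis
      by (simp add: column_single_column matrix_eq)
  qed
  obtain i j :: 'd where "i \<noteq> j"
    using d card_le_Suc0_iff_eq[of "UNIV :: 'd set"] by auto
  \<comment> \<open>\<open>Z\<close> differs from \<open>?C\<close> by a matrix with zero
    \<open>i\<close>-th column, and \<open>?C\<close> has zero \<open>j\<close>-th column, so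
    \<open>G_local\<close> applies twice.\<close>
  have G_const: "G Z = G 0" for Z
  proof -
    let ?C = "single_column i (column i Z)"
    have "G (?C + (Z - ?C)) = G ?C"
      by (rule G_local[of i]) (simp add: linear_diff[OF linear_column] column_single_column)
    also have "\<dots> = G (0 + ?C)" by simp
    also have "\<dots> = G 0"
      by (rule G_local[of j]) (use \<open>i \<noteq> j\<close> in \<open>simp add: column_single_column\<close>)
    finally show ?thesis by simp
  qed
  have "((\<lambda>Z. \<eta> Z - G 0 ** Z) has_derivative (\<lambda>A. 0)) (at Z within UNIV)" for Z
    using has_derivative_diff[OF D[of Z] affine_has_derivative[of "G 0" 0 Z]]
    by (simp add: G_const[of Z])
  from has_derivative_zero_constant[OF convex_UNIV this]
  obtain V where "\<And>Z. \<eta> Z - G 0 ** Z = V" by blast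
  then have "\<eta> = (\<lambda>Z. G 0 ** Z + V)"
    by (metis (no_types, lifting) ext add.commute diff_add_cancel)
  then show ?thesis using that G(1) by blast
qed

lemma affine_in_Diff_OmegaW:
  assumes "g \<in> Sp"
  shows "(\<lambda>Z. g ** Z + V) \<in> Diff_OmegaW"
proof -
  obtain \<gamma> where \<gamma>: "smooth \<gamma>" "\<forall>t\<in>{0..1}. \<gamma> t \<in> Sp" "\<gamma> (0::real) = mat 1" "\<gamma> 1 = g"
    using Sp_reachable[OF assms] unfolding Sp_reachable_def by blast
  \<comment> \<open>The linear part follows a path in \<open>Sp\<close> while the translation grows
    linearly in time.\<close>
  let ?H = "\<lambda>t Z. \<gamma> t ** Z + t *\<^sub>R V"
  have "smooth (\<lambda>x. \<gamma> (fst x) ** snd x + fst x *\<^sub>R V)"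
    by (intro smooth_add smooth_bilinear[OF bounded_bilinear_matrix_matrix_mult] smooth_linear
        smooth_compose_linear[OF \<gamma>(1)] bounded_linear_intros)
  then have "smooth (\<lambda>(t, Z). ?H t Z)"
    by (simp add: case_prod_unfold)
  then show ?thesis
    unfolding Diff_OmegaW_def using \<gamma>
    by (auto intro!: exI[of _ ?H] affine_in_preserving_diffeos)
qed

text \<open>The end point of a path preserves the form and is therefore affine; conversely every
  affine symplectic map is joined to the identity.\<close>

lemma Diff_OmegaW_eq:
  assumes "CARD('d::finite) \<ge> 2"
  shows "(Diff_OmegaW :: (('d, 'k::finite) linWV \<Rightarrow> ('d, 'k) linWV) set) =
    {\<eta>. \<exists>g\<in>Sp. \<exists>V. \<eta> = (\<lambda>Z. g ** Z + V)}"
proof (intro equalityI subsetI)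
  fix \<eta> :: "('d, 'k) linWV \<Rightarrow> ('d, 'k) linWV"
  assume "\<eta> \<in> Diff_OmegaW"
  then obtain H :: "real \<Rightarrow> _" where "\<forall>t\<in>{0..1}. H t \<in> preserving_diffeos" "H 1 = \<eta>"
    unfolding Diff_OmegaW_def by blast
  then have "\<eta> \<in> preserving_diffeos" by auto
  from preserving_diffeo_affine[OF assms this]
  show "\<eta> \<in> {\<eta>. \<exists>g\<in>Sp. \<exists>V. \<eta> = (\<lambda>Z. g ** Z + V)}" by blast
qed (auto intro: affine_in_Diff_OmegaW)

section \<open>The cocycle on affine maps\<close>

text \<open>A constant 1-form integrates along any smooth curve to its value on the displacement, by
  the fundamental theorem of calculus.\<close>

lemma integral_between_linear:
  assumes L: "bounded_linear L"
  shows "integral_between (\<lambda>_. L) a b = L (b - a)"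
proof -
  have I: "has_line_integral (\<lambda>_. L) \<gamma> (L (b - a))"
    if \<gamma>: "smooth \<gamma>" "\<gamma> 0 = a" "\<gamma> 1 = b" for \<gamma>
  proof -
    have "(\<gamma> has_vector_derivative vector_derivative \<gamma> (at t)) (at t)" for t
      unfolding vector_derivative_works[symmetric]
      by (rule differentiableI[OF smooth_has_derivative[OF \<gamma>(1)]])
    then have "((\<lambda>t. vector_derivative \<gamma> (at t)) has_integral (\<gamma> 1 - \<gamma> 0)) {0..1}"
      by (intro fundamental_theorem_of_calculus[OF zero_le_one]) (rule has_vector_derivative_at_within)
    from has_integral_linear[OF this L] show ?thesis
      unfolding has_line_integral_def o_def \<gamma>(2,3) .
  qed
  \<comment> \<open>Uniqueness in the description operator requires at least one smooth curve; the
    straight line provides it.\<close>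
  have line: "smooth (\<lambda>t. a + t *\<^sub>R (b - a))"
    by (intro smooth_add smooth_const smooth_linear bounded_linear_intros)
  show ?thesis
    unfolding integral_between_def
  proof (rule the_equality)
    fix J
    assume "\<forall>\<gamma>. smooth \<gamma> \<and> \<gamma> 0 = a \<and> \<gamma> 1 = b \<longrightarrow> has_line_integral (\<lambda>_. L) \<gamma> J"
    then have "has_line_integral (\<lambda>_. L) (\<lambda>t. a + t *\<^sub>R (b - a)) J"
      using line by simp
    then show "J = L (b - a)"
      using I[OF line] unfolding has_line_integral_def by (auto intro: has_integral_unique)
  qed (use I in blast)
qed

lemma transpose_add: "transpose (A + B) = transpose A + transpose B"
  by (simp add: transpose_def vec_eq_iff)

lemma transpose_minus: "transpose (- A) = - transpose A"
  by (simp add: transpose_def vec_eq_iff)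

lemma linear_sym_part: "linear sym_part"
  by (intro linearI) (simp_all add: vec_eq_iff sym_part_def transpose_def algebra_simps)

text \<open>Free of Darboux coordinates, the primitive is half the contraction of the form with
  \<open>Z\<close>, so its invariance under \<open>Sp\<close> follows from
  \<open>pairing_invariant\<close>.\<close>

lemma alphaW_eq: "alphaW Z A = (1/2) *\<^sub>R sym_part (transpose Z ** Omega ** A)"
proof -
  have "transpose (pos Z) ** mom A - transpose (mom Z) ** pos A = transpose Z ** Omega ** A"
    unfolding vec_eq_iff pairing_entry
    by (simp add: sympl_explicit column_def pos_def mom_def matrix_matrix_mult_def transpose_def
        sum_subtractf)
  then show ?thesis by (simp add: alphaW_def)
qed

lemma bounded_linear_pairing:
  "bounded_linear (\<lambda>A. (1/2) *\<^sub>R sym_part (M ** A))" for M :: "real^'n::finite^'d::finite"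
  using bounded_linear_compose[OF bounded_linear_scaleR_right
      bounded_linear_compose[OF linear_conv_bounded_linear[THEN iffD1, OF linear_sym_part]
        matmul.bounded_linear_right]] .

text \<open>The linear part preserves \<open>alphaW\<close>; the translation contributes a 1-form
  independent of \<open>Z\<close>, which integrates to its value on \<open>\<eta> 0\<close>.\<close>

lemma cocycle_B_affine:
  assumes "g \<in> Sp"
  shows "cocycle_B (\<lambda>Z. g ** Z + V) \<eta> = (1/2) *\<^sub>R sym_part (transpose V ** Omega ** g ** \<eta> 0)"
proof -
  have "pullback1 (\<lambda>Z. g ** Z + V) alphaW Z A - alphaW Z A =
      (1/2) *\<^sub>R sym_part (transpose V ** Omega ** g ** A)" for Z A
  proof -
    have "transpose (g ** Z + V) ** Omega ** (g ** A) =
        transpose Z ** Omega ** A + transpose V ** Omega ** g ** A"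
      using pairing_invariant[OF assms, of Z A]
      by (simp add: transpose_add matrix_mul_assoc matmul.add_left)
    then show ?thesis
      by (simp add: pullback1_def frechet_derivative_affine alphaW_eq linear_add[OF linear_sym_part]
          scaleR_right_distrib)
  qed
  then show ?thesis
    unfolding cocycle_B_def by (simp add: integral_between_linear[OF bounded_linear_pairing])
qed

section \<open>The isomorphism\<close>

lemma sym_part_Sym: "sym_part M \<in> Sym"
  by (simp add: Sym_def sym_part_def vec_eq_iff transpose_def)

lemma subspace_Sym: "subspace Sym"
  by (auto simp: subspace_def Sym_def transpose_add transpose_scalar)
    (simp add: transpose_def vec_eq_iff)

text \<open>The matrix is antisymmetric. This removes the cocycle term in the product of an element
  with its inverse.\<close>

lemma sym_part_self_pairing: "sym_part (transpose A ** Omega ** A) = 0"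
proof -
  have "OmegaW 0 A A $ i $ j = 0" for i j
    using sympl_commute[of "column i A" "column j A"] by (simp add: OmegaW_entry)
  then show ?thesis by (simp add: OmegaW_def vec_eq_iff)
qed

lemma jacobi_group_group:
  "group (jacobi_group :: ('k::finite endV \<times> ('d::finite, 'k) linWV \<times> 'd formW) monoid)"
    (is "group ?J")
proof (rule groupI)
  note Sym_closed = subspace_add[OF subspace_Sym] subspace_scale[OF subspace_Sym]
    subspace_neg[OF subspace_Sym] subspace_0[OF subspace_Sym]
  show "x \<otimes>\<^bsub>?J\<^esub> y \<in> carrier ?J" if "x \<in> carrier ?J" "y \<in> carrier ?J" for x y
    using that by (auto simp: jacobi_group_def Sp_mult Sym_closed sym_part_Sym)
  show "\<one>\<^bsub>?J\<^esub> \<in> carrier ?J"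
    by (simp add: jacobi_group_def Sp_one Sym_closed)
  show "\<one>\<^bsub>?J\<^esub> \<otimes>\<^bsub>?J\<^esub> x = x" if "x \<in> carrier ?J" for x
    by (cases x) (simp add: jacobi_group_def transpose_def[of 0] linear_0[OF linear_sym_part]
        flip: zero_vec_def)
  show "x \<otimes>\<^bsub>?J\<^esub> y \<otimes>\<^bsub>?J\<^esub> z = x \<otimes>\<^bsub>?J\<^esub> (y \<otimes>\<^bsub>?J\<^esub> z)"
    if "x \<in> carrier ?J" "y \<in> carrier ?J" "z \<in> carrier ?J" for x y z
  proof -
    obtain g A S g' A' S' g'' A'' S''
      where eqs: "x = (g, A, S)" "y = (g', A', S')" "z = (g'', A'', S'')"
      by (metis prod_cases3)
    then have "g \<in> Sp" using that by (simp add: jacobi_group_def)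
    \<comment> \<open>The cocycle identity: invariance under \<open>g\<close> turns the extra term
      of the left bracketing into the inner cocycle of the right one.\<close>
    then have "transpose (g ** A') ** Omega ** (g ** g' ** A'') = transpose A' ** Omega ** g' ** A''"
      using pairing_invariant[of g A' "g' ** A''"] by (simp add: matrix_mul_assoc)
    then have "transpose (A + g ** A') ** Omega ** (g ** g') ** A'' =
        transpose A ** Omega ** (g ** g') ** A'' + transpose A' ** Omega ** g' ** A''"
      by (simp add: transpose_add matrix_mul_assoc matmul.add_left)
    then show ?thesis
      unfolding eqs
      by (simp add: jacobi_group_def matrix_mul_assoc matmul.add_right
          linear_add[OF linear_sym_part] scaleR_right_distrib)
  qed
  show "\<exists>y\<in>carrier ?J. y \<otimes>\<^bsub>?J\<^esub> x = \<one>\<^bsub>?J\<^esub>" if "x \<in> carrier ?J" for x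
  proof -
    obtain g A S where x: "x = (g, A, S)" by (cases x)
    then have "g \<in> Sp" using that by (simp add: jacobi_group_def)
    then obtain h where h: "h \<in> Sp" "h ** g = mat 1"
      using Sp_inverse by blast
    have "sym_part (transpose (- (h ** A)) ** Omega ** h ** A) =
        - sym_part (transpose (h ** A) ** Omega ** (h ** A))"
      by (simp add: transpose_minus matmul.minus_left matrix_mul_assoc linear_neg[OF linear_sym_part])
    then show ?thesis
      unfolding x using h that
      by (intro bexI[of _ "(h, - (h ** A), - S)"])
        (auto simp: x jacobi_group_def Sym_closed sym_part_self_pairing)
  qed
qed

theorem mainTheorem7:
  assumes "CARD('d::finite) \<ge> 2"
  shows "group (jacobi_group :: ('k::finite endV \<times> ('d, 'k) linWV \<times> 'd formW) monoid) \<and>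
    group (quantomorphism_group :: ((('d, 'k) linWV \<Rightarrow> ('d, 'k) linWV) \<times> 'd formW) monoid) \<and>
    (\<lambda>(g :: 'k endV, V :: ('d, 'k) linWV, S :: 'd formW). ((\<lambda>Z. g ** Z + V), S))
      \<in> iso jacobi_group quantomorphism_group"
proof -
  let ?J = "jacobi_group :: ('k endV \<times> ('d, 'k) linWV \<times> 'd formW) monoid"
  let ?Q = "quantomorphism_group :: ((('d, 'k) linWV \<Rightarrow> ('d, 'k) linWV) \<times> 'd formW) monoid"
  let ?\<Phi> = "\<lambda>(g :: 'k endV, V :: ('d, 'k) linWV, S :: 'd formW). ((\<lambda>Z. g ** Z + V), S)"
  \<comment> \<open>\<open>Z = 0\<close> recovers the translation, and matrices with a single
    nonzero column recover the action of \<open>g\<close> on vectors.\<close>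
  have inj: "g = g' \<and> V = V'" if "(\<lambda>Z. g ** Z + V) = (\<lambda>Z. g' ** Z + V')"
    for g g' :: "'k endV" and V V' :: "('d, 'k) linWV"
  proof -
    have eq: "g ** Z + V = g' ** Z + V'" for Z using that by meson
    from eq[of 0] have V: "V = V'" by simp
    have "g ** single_column (undefined :: 'd) u = g' ** single_column undefined u" for u
      using eq[of "single_column undefined u"] by (simp add: V)
    then have "g *v u = g' *v u" for u
      by (metis column_matrix_mult column_single_column)
    then show ?thesis by (simp add: V matrix_eq)
  qed
  have "(\<lambda>Z. g ** Z + V) \<circ> (\<lambda>Z. g' ** Z + V') = (\<lambda>Z. (g ** g') ** Z + (V + g ** V'))"
    for g g' :: "'k endV" and V V' :: "('d, 'k) linWV"
    by (simp add: fun_eq_iff matrix_add_ldistrib matrix_mul_assoc add_ac)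
  then have "?\<Phi> \<in> hom ?J ?Q"
    by (auto simp: hom_def jacobi_group_def quantomorphism_group_def affine_in_Diff_OmegaW
        cocycle_B_affine subspace_add[OF subspace_Sym])
  moreover have "bij_betw ?\<Phi> (carrier ?J) (carrier ?Q)"
    unfolding bij_betw_def
  proof
    show "inj_on ?\<Phi> (carrier ?J)"
      using inj by (auto intro!: inj_onI)
    \<comment> \<open>Surjectivity is where \<open>CARD('d) \<ge> 2\<close> enters, through rigidity
      of the form-preserving diffeomorphisms.\<close>
    show "?\<Phi> ` carrier ?J = carrier ?Q"
      by (auto simp: jacobi_group_def quantomorphism_group_def Diff_OmegaW_eq[OF assms] image_iff)
        blast
  qed
  ultimately have iso: "?\<Phi> \<in> iso ?J ?Q" by (simp add: iso_def)
  \<comment> \<open>The group laws are transported along the isomorphism; this makes the image of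
    the unit the new unit, so it has to be identified.\<close>
  have "?\<Phi> \<one>\<^bsub>?J\<^esub> = \<one>\<^bsub>?Q\<^esub>"
    by (simp add: jacobi_group_def quantomorphism_group_def fun_eq_iff)
  then have "group ?Q"
    using group.iso_imp_img_group[OF jacobi_group_group iso] by simp
  then show ?thesis using jacobi_group_group iso by simp
qed

end
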